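(* Let $3<p<\infty$ and $\frac1p+\frac1q=1$. Define $F:l_p\times l_p\to l_q$ by $F(x,y)=J(x)+\mathcal J(y)$ for $(x,y)\in l_p\times l_p$. Then for any $\bar x=(\bar t_1,\bar t_2,\dots)\in l_p$ and $\bar y=(\bar s_1,\bar s_2,\dots)\in l_p$: (i) (a) $F$ is partially Gâteaux differentiable at $(\theta,\bar y)$ with respect to the first variable and $\partial_1F(\theta,\bar y)(v)=J(v)$ for any $v\in l_p\setminus\{\theta\}$; (b) $F$ is not partially Fréchet differentiable at $(\theta,\bar y)$ with respect to the first variable, that is, $\nabla_1F(\theta,\bar y)$ does not exist. (ii) (a) $F$ is partially Gâteaux differentiable on $l_p\times l_p$ with respect to the second variable and $$\partial_2F(\bar x,\bar y)(v)=\nabla_2F(\bar x,\bar y)(v)=\{(p-1)|\bar s_n|^{p-2}t_n\}_{n=1}^\infty\in l_q\quad\text{for } v=\{t_n\}_{n=1}^\infty\in l_p\setminus\{\theta\};$$ (b) $F$ is partially Fréchet differentiable on $l_p\times l_p$ with respect to the second variable and $$\nabla_2F(\bar x,\bar y)=\nabla\mathcal J(\bar y)=(p-1)\begin{pmatrix}|\bar s_1|^{p-2}&0&\cdots\\0&|\bar s_2|^{p-2}&0\\\vdots&0&\ddots\end{pmatrix}.$$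
   Context: $l_p$ is the real sequence space with norm $\|\cdot\|_p$, whose dual is $l_q$; $\theta=(0,0,\dots)$. A diagonal matrix with diagonal entries $d_1,d_2,\dots$ denotes the operator $\{t_n\}\mapsto\{d_nt_n\}$ from $l_p$ to $l_q$. The normalized duality mapping $J:l_p\to l_q$ is given by $J(\theta)=\theta$ and, for $x=(t_1,t_2,\dots)\ne\theta$, $J(x)=\left\{\frac{|t_n|^{p-1}\operatorname{sign}(t_n)}{\|x\|_p^{p-2}}\right\}_{n=1}^\infty$. The duality mapping $\mathcal J:l_p\to l_q$ is given by $\mathcal J(x)=\{|t_n|^{p-1}\operatorname{sign}(t_n)\}_{n=1}^\infty$. $\nabla\mathcal J(\bar y)$ denotes the Fréchet derivative of $\mathcal J$ at $\bar y$. For $F:l_p\times l_p\to l_q$: $F$ is partially Gâteaux differentiable with respect to the first variable at $(\bar x,\bar y)$ if for every $v\in l_p\setminus\{\theta\}$ the limit (over real $t$) $\partial_1F(\bar x,\bar y)(v):=\lim_{t\to0}\frac{F(\bar x+tv,\bar y)-F(\bar x,\bar y)}{t}$ exists in $l_q$; with respect to the second variable if $\partial_2F(\bar x,\bar y)(v):=\lim_{t\to0}\frac{F(\bar x,\bar y+tv)-F(\bar x,\bar y)}{t}$ exists for every $v\in l_p\setminus\{\theta\}$. $F$ is partially Fréchet differentiable with respect to the first variable at $(\bar x,\bar y)$ if there is a continuous linear $\nabla_1F(\bar x,\bar y):l_p\to l_q$ with $\lim_{u\to\theta}\frac{F(\bar x+u,\bar y)-F(\bar x,\bar y)-\nabla_1F(\bar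 x,\bar y)(u)}{\|u\|_p}=\theta$; with respect to the second variable if there is a continuous linear $\nabla_2F(\bar x,\bar y):l_p\to l_q$ with $\lim_{w\to\theta}\frac{F(\bar x,\bar y+w)-F(\bar x,\bar y)-\nabla_2F(\bar x,\bar y)(w)}{\|w\|_p}=\theta$. *)

theory Defs
  imports Complex_Main "HOL-Library.FuncSet"
begin

text \<open>
  The exponent \<open>p\<close> ranges over the reals, so \<open>l_p\<close> is a set of sequences rather than a type.
  Sequences are indexed from 0.
\<close>

definition lp_space :: "real \<Rightarrow> (nat \<Rightarrow> real) set" where
  "lp_space p = {x. summable (\<lambda>n. \<bar>x n\<bar> powr p)}"

definition lp_norm :: "real \<Rightarrow> (nat \<Rightarrow> real) \<Rightarrow> real" where
  "lp_norm p x = (\<Sum>n. \<bar>x n\<bar> powr p) powr (1 / p)"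

definition lp_zero :: "nat \<Rightarrow> real" where
  "lp_zero = (\<lambda>n. 0)"

text \<open>The neighbourhood filters of \<open>l_p\<close>; the second one is punctured at \<open>x\<close>.\<close>

definition lp_nhds :: "real \<Rightarrow> (nat \<Rightarrow> real) \<Rightarrow> (nat \<Rightarrow> real) filter" where
  "lp_nhds p x = inf (filtercomap (\<lambda>u. lp_norm p (\<lambda>n. u n - x n)) (nhds 0)) (principal (lp_space p))"

definition lp_at :: "real \<Rightarrow> (nat \<Rightarrow> real) \<Rightarrow> (nat \<Rightarrow> real) filter" where
  "lp_at p x = inf (lp_nhds p x) (principal (- {x}))"

text \<open>
  Convergence in \<open>l_p\<close>. The limit lies in \<open>l_p\<close>, and by the definition of \<open>lp_nhds\<close> so do,
  eventually, the values of \<open>f\<close>.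
\<close>

definition lp_tendsto :: "real \<Rightarrow> ('a \<Rightarrow> nat \<Rightarrow> real) \<Rightarrow> (nat \<Rightarrow> real) \<Rightarrow> 'a filter \<Rightarrow> bool" where
  "lp_tendsto p f L F \<longleftrightarrow> L \<in> lp_space p \<and> filterlim f (lp_nhds p L) F"

text \<open>
  Operators are extensional functions (\<open>undefined\<close> outside \<open>l_p\<close>), so that equality of
  operators is equality in HOL.
\<close>

definition lp_continuous_linear ::
    "real \<Rightarrow> real \<Rightarrow> ((nat \<Rightarrow> real) \<Rightarrow> (nat \<Rightarrow> real)) \<Rightarrow> bool" where
  "lp_continuous_linear p q A \<longleftrightarrow>
     A \<in> lp_space p \<rightarrow>\<^sub>E lp_space q \<and>
     (\<forall>x\<in>lp_space p. \<forall>y\<in>lp_space p. A (\<lambda>n. x n + y n) = (\<lambda>n. A x n + A y n)) \<and>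
     (\<forall>c. \<forall>x\<in>lp_space p. A (\<lambda>n. c * x n) = (\<lambda>n. c * A x n)) \<and>
     (\<forall>x\<in>lp_space p. lp_tendsto q A (A x) (lp_nhds p x))"

definition diagonal_operator :: "real \<Rightarrow> (nat \<Rightarrow> real) \<Rightarrow> (nat \<Rightarrow> real) \<Rightarrow> (nat \<Rightarrow> real)" where
  "diagonal_operator p d = (\<lambda>x\<in>lp_space p. (\<lambda>n. d n * x n))"

definition has_gateaux_limit ::
    "real \<Rightarrow> ((nat \<Rightarrow> real) \<Rightarrow> (nat \<Rightarrow> real)) \<Rightarrow> (nat \<Rightarrow> real) \<Rightarrow> (nat \<Rightarrow> real) \<Rightarrow> (nat \<Rightarrow> real) \<Rightarrow> bool" where
  "has_gateaux_limit q G x v L \<longleftrightarrow>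
     lp_tendsto q (\<lambda>t n. (G (\<lambda>k. x k + t * v k) n - G x n) / t) L (at (0::real))"

definition gateaux_differentiable ::
    "real \<Rightarrow> real \<Rightarrow> ((nat \<Rightarrow> real) \<Rightarrow> (nat \<Rightarrow> real)) \<Rightarrow> (nat \<Rightarrow> real) \<Rightarrow> bool" where
  "gateaux_differentiable p q G x \<longleftrightarrow> (\<forall>v\<in>lp_space p - {lp_zero}. \<exists>L. has_gateaux_limit q G x v L)"

definition gateaux_deriv ::
    "real \<Rightarrow> ((nat \<Rightarrow> real) \<Rightarrow> (nat \<Rightarrow> real)) \<Rightarrow> (nat \<Rightarrow> real) \<Rightarrow> (nat \<Rightarrow> real) \<Rightarrow> (nat \<Rightarrow> real)" where
  "gateaux_deriv q G x v = (THE L. has_gateaux_limit q G x v L)"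

definition has_frechet_deriv ::
    "real \<Rightarrow> real \<Rightarrow> ((nat \<Rightarrow> real) \<Rightarrow> (nat \<Rightarrow> real)) \<Rightarrow>
     ((nat \<Rightarrow> real) \<Rightarrow> (nat \<Rightarrow> real)) \<Rightarrow> (nat \<Rightarrow> real) \<Rightarrow> bool" where
  "has_frechet_deriv p q G A x \<longleftrightarrow>
     lp_continuous_linear p q A \<and>
     lp_tendsto q (\<lambda>u n. (G (\<lambda>k. x k + u k) n - G x n - A u n) / lp_norm p u)
       lp_zero (lp_at p lp_zero)"

definition frechet_differentiable ::
    "real \<Rightarrow> real \<Rightarrow> ((nat \<Rightarrow> real) \<Rightarrow> (nat \<Rightarrow> real)) \<Rightarrow> (nat \<Rightarrow> real) \<Rightarrow> bool" where
  "frechet_differentiable p q G x \<longleftrightarrow> (\<exists>A. has_frechet_deriv p q G A x)"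

definition frechet_deriv ::
    "real \<Rightarrow> real \<Rightarrow> ((nat \<Rightarrow> real) \<Rightarrow> (nat \<Rightarrow> real)) \<Rightarrow> (nat \<Rightarrow> real) \<Rightarrow> (nat \<Rightarrow> real) \<Rightarrow> (nat \<Rightarrow> real)" where
  "frechet_deriv p q G x = (THE A. has_frechet_deriv p q G A x)"

type_synonym seq_map2 = "(nat \<Rightarrow> real) \<times> (nat \<Rightarrow> real) \<Rightarrow> (nat \<Rightarrow> real)"

definition partial_gateaux_differentiable1 :: "real \<Rightarrow> real \<Rightarrow> seq_map2 \<Rightarrow> (nat \<Rightarrow> real) \<times> (nat \<Rightarrow> real) \<Rightarrow> bool" where
  "partial_gateaux_differentiable1 p q F = (\<lambda>(x, y). gateaux_differentiable p q (\<lambda>u. F (u, y)) x)"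

definition partial_gateaux_differentiable2 :: "real \<Rightarrow> real \<Rightarrow> seq_map2 \<Rightarrow> (nat \<Rightarrow> real) \<times> (nat \<Rightarrow> real) \<Rightarrow> bool" where
  "partial_gateaux_differentiable2 p q F = (\<lambda>(x, y). gateaux_differentiable p q (\<lambda>w. F (x, w)) y)"

definition partial_gateaux_deriv1 ::
    "real \<Rightarrow> seq_map2 \<Rightarrow> (nat \<Rightarrow> real) \<times> (nat \<Rightarrow> real) \<Rightarrow> (nat \<Rightarrow> real) \<Rightarrow> (nat \<Rightarrow> real)" where
  "partial_gateaux_deriv1 q F = (\<lambda>(x, y). gateaux_deriv q (\<lambda>u. F (u, y)) x)"

definition partial_gateaux_deriv2 ::
    "real \<Rightarrow> seq_map2 \<Rightarrow> (nat \<Rightarrow> real) \<times> (nat \<Rightarrow> real) \<Rightarrow> (nat \<Rightarrow> real) \<Rightarrow> (nat \<Rightarrow> real)" where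
  "partial_gateaux_deriv2 q F = (\<lambda>(x, y). gateaux_deriv q (\<lambda>w. F (x, w)) y)"

definition partial_frechet_differentiable1 :: "real \<Rightarrow> real \<Rightarrow> seq_map2 \<Rightarrow> (nat \<Rightarrow> real) \<times> (nat \<Rightarrow> real) \<Rightarrow> bool" where
  "partial_frechet_differentiable1 p q F = (\<lambda>(x, y). frechet_differentiable p q (\<lambda>u. F (u, y)) x)"

definition partial_frechet_differentiable2 :: "real \<Rightarrow> real \<Rightarrow> seq_map2 \<Rightarrow> (nat \<Rightarrow> real) \<times> (nat \<Rightarrow> real) \<Rightarrow> bool" where
  "partial_frechet_differentiable2 p q F = (\<lambda>(x, y). frechet_differentiable p q (\<lambda>w. F (x, w)) y)"

definition partial_frechet_deriv2 ::
    "real \<Rightarrow> real \<Rightarrow> seq_map2 \<Rightarrow> (nat \<Rightarrow> real) \<times> (nat \<Rightarrow> real) \<Rightarrow> (nat \<Rightarrow> real) \<Rightarrow> (nat \<Rightarrow> real)" where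
  "partial_frechet_deriv2 p q F = (\<lambda>(x, y). frechet_deriv p q (\<lambda>w. F (x, w)) y)"

definition duality_map :: "real \<Rightarrow> (nat \<Rightarrow> real) \<Rightarrow> (nat \<Rightarrow> real)" where
  "duality_map p x = (\<lambda>n. \<bar>x n\<bar> powr (p - 1) * sgn (x n))"

definition normalized_duality_map :: "real \<Rightarrow> (nat \<Rightarrow> real) \<Rightarrow> (nat \<Rightarrow> real)" where
  "normalized_duality_map p x =
     (if x = lp_zero then lp_zero
      else (\<lambda>n. \<bar>x n\<bar> powr (p - 1) * sgn (x n) / lp_norm p x powr (p - 2)))"

lemma duality_map_in_lp_space:
  assumes "1 < p" "1 / p + 1 / q = 1" "x \<in> lp_space p"
  shows "duality_map p x \<in> lp_space q"
proof -
  have "q \<noteq> 0" using assms by auto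
  then have pq: "(p - 1) * q = p" using assms by (simp add: field_simps)
  have "\<bar>duality_map p x n\<bar> powr q = \<bar>x n\<bar> powr p" for n
    using pq by (cases "x n = 0") (simp_all add: duality_map_def abs_mult powr_powr)
  then show ?thesis using assms(3) by (simp add: lp_space_def)
qed

lemma normalized_duality_map_in_lp_space:
  assumes "1 < p" "1 / p + 1 / q = 1" "x \<in> lp_space p"
  shows "normalized_duality_map p x \<in> lp_space q"
proof (cases "x = lp_zero")
  case True
  then show ?thesis by (simp add: normalized_duality_map_def lp_space_def lp_zero_def)
next
  case False
  let ?c = "lp_norm p x powr (p - 2)"
  have "\<bar>normalized_duality_map p x n\<bar> powr q = \<bar>duality_map p x n\<bar> powr q / ?c powr q" for n
    using False by (simp add: normalized_duality_map_def duality_map_def powr_divide)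
  then show ?thesis
    using duality_map_in_lp_space[OF assms] by (simp add: lp_space_def summable_divide)
qed

end

theory Submission imports Defs begin

text \<open>
  Both duality mappings are built from the scalar function \<open>\<phi> s = \<bar>s\<bar> powr (p - 1) * sgn s\<close>, and
  the theorem contrasts two of their properties.

  \<^emph>\<open>First variable.\<close> The map \<open>J = normalized_duality_map p\<close> satisfies
  \<open>J (t v) = t J v\<close> for scalars \<open>t\<close> of either sign (\<open>normalized_duality_map_scale\<close>), so the
  difference quotient of \<open>J\<close> at the origin in the direction \<open>v\<close> is constantly \<open>J v\<close>; this is
  Gateaux differentiability. A Frechet derivative would have to agree with all directional
  derivatives (\<open>has_frechet_deriv_imp_gateaux\<close>), hence with \<open>J\<close>, but \<open>J\<close> is not additive: on the
  sum of two distinct unit vectors the norm in the denominator exceeds 1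
  (\<open>normalized_duality_map_not_additive\<close>).

  \<^emph>\<open>Second variable.\<close> Here \<open>J x\<close> is a constant, so only \<open>duality_map\<close> matters. For \<open>p > 3\<close> the
  function \<open>\<phi>\<close> is twice differentiable, and two applications of the mean value theorem bound its
  first order Taylor remainder at \<open>s\<close> by \<open>(p - 1) (p - 2) (\<bar>s\<bar> + \<bar>t\<bar>) powr (p - 3) * t\<^sup>2\<close>
  (\<open>signed_powr_taylor_bound\<close>). Sequences bounded by \<open>\<bar>a\<bar> powr \<alpha> * \<bar>u\<bar> powr \<beta>\<close> with
  \<open>\<alpha> + \<beta> = p - 1\<close> and \<open>a\<close>, \<open>u\<close> in \<open>l_p\<close> belong to \<open>l_q\<close>, with norm of order
  \<open>lp_norm p u powr \<beta>\<close> (\<open>lp_norm_product_bound\<close>, a substitute for Hoelder's inequality). For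
  \<open>\<beta> = 1\<close> this makes the candidate derivative, a diagonal operator, continuous from \<open>l_p\<close> to
  \<open>l_q\<close>; for \<open>\<beta> = 2\<close> it makes the remainder quadratically small. Uniqueness of limits then
  identifies the derivatives, which are given by definite descriptions.
\<close>

section \<open>Power sums and the norm of \<open>l_p\<close>\<close>

definition power_sum :: "real \<Rightarrow> (nat \<Rightarrow> real) \<Rightarrow> real" where
  "power_sum p x = (\<Sum>n. \<bar>x n\<bar> powr p)"

lemma lp_norm_power_sum: "lp_norm p x = power_sum p x powr (1 / p)"
  by (simp add: lp_norm_def power_sum_def)

lemma power_sum_nonneg: "x \<in> lp_space p \<Longrightarrow> 0 \<le> power_sum p x"
  by (auto simp: power_sum_def lp_space_def intro: suminf_nonneg)

lemma lp_norm_nonneg: "0 \<le> lp_norm p x"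
  by (simp add: lp_norm_def)

lemma lp_norm_powr:
  assumes "0 < p" "x \<in> lp_space p"
  shows "lp_norm p x powr p = power_sum p x"
  using assms power_sum_nonneg[of x p] by (simp add: lp_norm_power_sum powr_powr)

lemma lp_zero_in_lp_space: "lp_zero \<in> lp_space p"
  by (simp add: lp_space_def lp_zero_def)

lemma lp_norm_lp_zero: "lp_norm p lp_zero = 0"
  by (simp add: lp_norm_def lp_zero_def)

lemma lp_space_scale: "x \<in> lp_space p \<Longrightarrow> (\<lambda>n. c * x n) \<in> lp_space p"
  by (simp add: lp_space_def abs_mult powr_mult summable_mult)

lemma power_sum_scale:
  "x \<in> lp_space p \<Longrightarrow> power_sum p (\<lambda>n. c * x n) = \<bar>c\<bar> powr p * power_sum p x"
  by (simp add: power_sum_def lp_space_def abs_mult powr_mult suminf_mult)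

lemma lp_norm_scale:
  assumes "0 < p" "x \<in> lp_space p"
  shows "lp_norm p (\<lambda>n. c * x n) = \<bar>c\<bar> * lp_norm p x"
  using assms power_sum_nonneg[of x p]
  by (simp add: lp_norm_power_sum power_sum_scale powr_mult powr_powr)

lemma abs_le_lp_norm:
  assumes "0 < p" "x \<in> lp_space p"
  shows "\<bar>x n\<bar> \<le> lp_norm p x"
proof -
  have "(\<Sum>k\<in>{n}. \<bar>x k\<bar> powr p) \<le> power_sum p x"
    unfolding power_sum_def using assms(2)
    by (intro sum_le_suminf) (auto simp: lp_space_def)
  then have "(\<bar>x n\<bar> powr p) powr (1 / p) \<le> lp_norm p x"
    unfolding lp_norm_power_sum using assms(1) by (intro powr_mono2) auto
  then show ?thesis using assms(1) by (simp add: powr_powr)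
qed

lemma lp_norm_pos:
  assumes "0 < p" "x \<in> lp_space p" "x \<noteq> lp_zero"
  shows "0 < lp_norm p x"
proof -
  obtain n where "x n \<noteq> 0" using assms(3) by (auto simp: lp_zero_def)
  then show ?thesis using abs_le_lp_norm[OF assms(1,2), of n] by linarith
qed

text \<open>The inequality \<open>(a + b) powr p \<le> 2 powr p * (a powr p + b powr p)\<close> is cruder than
  Minkowski's, but it suffices both for \<open>l_p\<close> to be closed under addition and for power sums to
  stay bounded under bounded perturbations.\<close>

lemma power_sum_add_bound:
  assumes "0 < p" "x \<in> lp_space p" "y \<in> lp_space p" "\<And>n. \<bar>z n\<bar> \<le> \<bar>x n\<bar> + \<bar>y n\<bar>"
  shows "z \<in> lp_space p" "power_sum p z \<le> 2 powr p * (power_sum p x + power_sum p y)"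
proof -
  have pointwise: "\<bar>z n\<bar> powr p \<le> 2 powr p * (\<bar>x n\<bar> powr p + \<bar>y n\<bar> powr p)" for n
  proof -
    define m where "m = max \<bar>x n\<bar> \<bar>y n\<bar>"
    have "\<bar>z n\<bar> powr p \<le> (2 * m) powr p"
      using assms(1) assms(4)[of n] by (intro powr_mono2) (auto simp: m_def)
    also have "\<dots> = 2 powr p * m powr p"
      by (simp add: powr_mult m_def)
    also have "m powr p \<le> \<bar>x n\<bar> powr p + \<bar>y n\<bar> powr p"
      by (simp add: m_def max_def)
    finally show ?thesis by simp
  qed
  have sx: "summable (\<lambda>n. \<bar>x n\<bar> powr p)" and sy: "summable (\<lambda>n. \<bar>y n\<bar> powr p)"
    using assms by (auto simp: lp_space_def)
  have s: "summable (\<lambda>n. 2 powr p * (\<bar>x n\<bar> powr p + \<bar>y n\<bar> powr p))"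
    by (intro summable_mult summable_add sx sy)
  have sz: "summable (\<lambda>n. \<bar>z n\<bar> powr p)"
    by (rule summable_comparison_test'[OF s, of 0]) (use pointwise in simp)
  then show "z \<in> lp_space p" by (simp add: lp_space_def)
  have "power_sum p z \<le> (\<Sum>n. 2 powr p * (\<bar>x n\<bar> powr p + \<bar>y n\<bar> powr p))"
    unfolding power_sum_def by (rule suminf_le[OF pointwise sz s])
  also have "\<dots> = 2 powr p * (power_sum p x + power_sum p y)"
    unfolding power_sum_def using sx sy
    by (simp add: suminf_mult summable_add suminf_add)
  finally show "power_sum p z \<le> 2 powr p * (power_sum p x + power_sum p y)" .
qed

lemma lp_space_add:
  assumes "0 < p" "x \<in> lp_space p" "y \<in> lp_space p"
  shows "(\<lambda>n. x n + y n) \<in> lp_space p"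
  by (rule power_sum_add_bound(1)[OF assms]) (rule abs_triangle_ineq)

lemma lp_space_diff:
  assumes "0 < p" "x \<in> lp_space p" "y \<in> lp_space p"
  shows "(\<lambda>n. x n - y n) \<in> lp_space p"
  by (rule power_sum_add_bound(1)[OF assms]) (rule abs_triangle_ineq4)

lemma conjugate_exponent:
  fixes p q :: real
  assumes "1 < p" "1 / p + 1 / q = 1"
  shows "0 < q" "(p - 1) * q = p"
proof -
  have "1 / p < 1" using assms(1) by simp
  then have "0 < 1 / q" using assms(2) by linarith
  then show "0 < q" by simp
  then show "(p - 1) * q = p" using assms by (simp add: field_simps)
qed

lemma powr_mult_powr_le_add:
  fixes a b :: real
  assumes "0 \<le> a" "0 \<le> b" "0 \<le> \<alpha>" "0 \<le> \<beta>"
  shows "a powr \<alpha> * b powr \<beta> \<le> a powr (\<alpha> + \<beta>) + b powr (\<alpha> + \<beta>)"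
proof -
  define m where "m = max a b"
  have "a powr \<alpha> * b powr \<beta> \<le> m powr \<alpha> * m powr \<beta>"
    using assms by (intro mult_mono powr_mono2) (auto simp: m_def)
  also have "\<dots> = m powr (\<alpha> + \<beta>)" by (simp add: powr_add)
  also have "\<dots> \<le> a powr (\<alpha> + \<beta>) + b powr (\<alpha> + \<beta>)" by (simp add: m_def max_def)
  finally show ?thesis .
qed

text \<open>
  Hoelder's inequality would give the sharp factor \<open>lp_norm p a powr \<alpha>\<close>; only the power of
  \<open>lp_norm p u\<close> matters below. That power is obtained by normalizing \<open>u\<close> to norm 1, after which the
  trivial bound \<open>powr_mult_powr_le_add\<close> can be summed termwise.
\<close>

lemma lp_norm_product_bound:
  assumes "1 < p" "1 / p + 1 / q = 1" "a \<in> lp_space p" "u \<in> lp_space p"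
    and "0 \<le> \<alpha>" "0 \<le> \<beta>" "\<alpha> + \<beta> = p - 1" "0 \<le> C"
    and bound: "\<And>n. \<bar>r n\<bar> \<le> C * (\<bar>a n\<bar> powr \<alpha> * \<bar>u n\<bar> powr \<beta>)"
  shows "r \<in> lp_space q"
    "lp_norm q r \<le> C * (power_sum p a + 1) powr (1 / q) * lp_norm p u powr \<beta>"
proof -
  note q = conjugate_exponent[OF assms(1,2)]
  have p0: "0 < p" using assms(1) by simp
  define h where "h = lp_norm p u"
  have exponents: "\<alpha> * q + \<beta> * q = p"
    using assms(7) q(2) by (simp flip: distrib_right)
  define K where "K = C powr q * h powr (\<beta> * q)"
  have term_bound: "\<bar>r n\<bar> powr q \<le> K * (\<bar>a n\<bar> powr p + \<bar>u n / h\<bar> powr p)" for n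
  proof -
    have "\<bar>r n\<bar> powr q \<le> (C * (\<bar>a n\<bar> powr \<alpha> * \<bar>u n\<bar> powr \<beta>)) powr q"
      using q(1) bound[of n] by (intro powr_mono2) auto
    also have "\<dots> = C powr q * (\<bar>a n\<bar> powr (\<alpha> * q) * \<bar>u n\<bar> powr (\<beta> * q))"
      by (simp add: powr_mult powr_powr assms(8))
    also have "\<bar>u n\<bar> powr (\<beta> * q) = h powr (\<beta> * q) * \<bar>u n / h\<bar> powr (\<beta> * q)"
    proof (cases "h = 0")
      case True
      \<comment> \<open>then \<open>u n\<close> vanishes as well, and both sides are 0\<close>
      then show ?thesis using abs_le_lp_norm[OF p0 assms(4), of n] by (simp add: h_def)
    next
      case False
      then have "0 < h" using lp_norm_nonneg[of p u] by (simp add: h_def)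
      then show ?thesis by (simp add: powr_divide abs_divide)
    qed
    also have "C powr q * (\<bar>a n\<bar> powr (\<alpha> * q) * (h powr (\<beta> * q) * \<bar>u n / h\<bar> powr (\<beta> * q)))
        = K * (\<bar>a n\<bar> powr (\<alpha> * q) * \<bar>u n / h\<bar> powr (\<beta> * q))"
      by (simp add: K_def)
    also have "\<dots> \<le> K * (\<bar>a n\<bar> powr (\<alpha> * q + \<beta> * q) + \<bar>u n / h\<bar> powr (\<alpha> * q + \<beta> * q))"
      using assms(5,6,8) q(1) by (intro mult_left_mono powr_mult_powr_le_add) (auto simp: K_def)
    finally show ?thesis by (simp only: exponents)
  qed
  define v where "v = (\<lambda>n. u n / h)"
  have v_scale: "v = (\<lambda>n. (1 / h) * u n)" by (simp add: v_def)
  have v: "v \<in> lp_space p"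
    unfolding v_scale by (rule lp_space_scale[OF assms(4)])
  have "power_sum p v \<le> 1"
  proof -
    have "power_sum p v = \<bar>1 / h\<bar> powr p * h powr p"
      unfolding v_scale power_sum_scale[OF assms(4)] h_def lp_norm_powr[OF p0 assms(4)] ..
    \<comment> \<open>not an equation, since the product is 0 when \<open>h = 0\<close>\<close>
    also have "\<dots> \<le> 1"
      using lp_norm_nonneg[of p u] by (simp add: h_def powr_divide)
    finally show ?thesis .
  qed
  have sa: "summable (\<lambda>n. \<bar>a n\<bar> powr p)" and sv: "summable (\<lambda>n. \<bar>v n\<bar> powr p)"
    using assms(3) v by (auto simp: lp_space_def)
  have s: "summable (\<lambda>n. K * (\<bar>a n\<bar> powr p + \<bar>v n\<bar> powr p))"
    by (intro summable_mult summable_add sa sv)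
  have sr: "summable (\<lambda>n. \<bar>r n\<bar> powr q)"
    by (rule summable_comparison_test'[OF s, of 0]) (use term_bound in \<open>simp add: v_def\<close>)
  then show "r \<in> lp_space q" by (simp add: lp_space_def)
  then have r0: "0 \<le> power_sum q r" by (rule power_sum_nonneg)
  have "power_sum q r \<le> (\<Sum>n. K * (\<bar>a n\<bar> powr p + \<bar>v n\<bar> powr p))"
    unfolding power_sum_def by (rule suminf_le[OF _ sr s]) (use term_bound in \<open>simp add: v_def\<close>)
  also have "\<dots> = K * (power_sum p a + power_sum p v)"
    unfolding power_sum_def using sa sv by (simp add: suminf_mult summable_add suminf_add)
  also have "\<dots> \<le> K * (power_sum p a + 1)"
    using \<open>power_sum p v \<le> 1\<close> by (intro mult_left_mono) (auto simp: K_def)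
  finally have "lp_norm q r \<le> (K * (power_sum p a + 1)) powr (1 / q)"
    unfolding lp_norm_power_sum using q(1) r0 by (intro powr_mono2) auto
  also have "\<dots> = C * (power_sum p a + 1) powr (1 / q) * h powr \<beta>"
    using q(1) power_sum_nonneg[OF assms(3)] assms(8)
    by (simp add: K_def powr_mult powr_powr)
  finally show "lp_norm q r \<le> C * (power_sum p a + 1) powr (1 / q) * lp_norm p u powr \<beta>"
    by (simp add: h_def)
qed

section \<open>Convergence in \<open>l_p\<close>\<close>

lemma filterlim_lp_nhds:
  "filterlim f (lp_nhds p L) F \<longleftrightarrow>
     ((\<lambda>a. lp_norm p (\<lambda>n. f a n - L n)) \<longlongrightarrow> 0) F \<and> (\<forall>\<^sub>F a in F. f a \<in> lp_space p)"
  by (simp add: lp_nhds_def filterlim_inf filterlim_principal filterlim_filtercomap_iff o_def)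

lemma lp_tendsto_iff:
  "lp_tendsto p f L F \<longleftrightarrow> L \<in> lp_space p \<and> (\<forall>\<^sub>F a in F. f a \<in> lp_space p) \<and>
     ((\<lambda>a. lp_norm p (\<lambda>n. f a n - L n)) \<longlongrightarrow> 0) F"
  by (auto simp: lp_tendsto_def filterlim_lp_nhds)

lemma lp_nhds_limits:
  "((\<lambda>u. lp_norm p (\<lambda>n. u n - x n)) \<longlongrightarrow> 0) (lp_nhds p x)"
  "\<forall>\<^sub>F u in lp_nhds p x. u \<in> lp_space p"
  using filterlim_lp_nhds[of "\<lambda>u. u" p x "lp_nhds p x"] by (auto simp: filterlim_ident)

lemma lp_tendsto_cong:
  assumes "lp_tendsto p f L F" "\<forall>\<^sub>F a in F. f a = g a"
  shows "lp_tendsto p g L F"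
  using assms filterlim_cong[OF refl refl assms(2)] by (auto simp: lp_tendsto_def)

lemma lp_tendsto_const:
  "L \<in> lp_space p \<Longrightarrow> lp_tendsto p (\<lambda>a. L) L F"
  using lp_norm_lp_zero[of p] by (simp add: lp_tendsto_iff lp_zero_def)

lemma lp_tendsto_coordinate:
  assumes "0 < p" "lp_tendsto p f L F"
  shows "((\<lambda>a. f a n) \<longlongrightarrow> L n) F"
proof -
  have "\<forall>\<^sub>F a in F. norm (f a n - L n) \<le> lp_norm p (\<lambda>n. f a n - L n)"
  proof (rule eventually_mono)
    show "\<forall>\<^sub>F a in F. f a \<in> lp_space p" using assms(2) by (simp add: lp_tendsto_iff)
    fix a assume "f a \<in> lp_space p"
    then have "(\<lambda>n. f a n - L n) \<in> lp_space p"
      using assms by (intro lp_space_diff) (auto simp: lp_tendsto_iff)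
    then show "norm (f a n - L n) \<le> lp_norm p (\<lambda>n. f a n - L n)"
      using abs_le_lp_norm[OF assms(1)] by simp
  qed
  then have bound: "\<forall>\<^sub>F a in F. norm (f a n - L n) \<le> norm (lp_norm p (\<lambda>n. f a n - L n)) * 1"
    by (simp add: lp_norm_nonneg)
  have "((\<lambda>a. lp_norm p (\<lambda>n. f a n - L n)) \<longlongrightarrow> 0) F"
    using assms(2) by (simp add: lp_tendsto_iff)
  from tendsto_0_le[OF this bound] have "((\<lambda>a. f a n - L n) \<longlongrightarrow> 0) F" .
  then show ?thesis by (simp add: LIM_zero_iff)
qed

lemma lp_tendsto_unique:
  assumes "0 < p" "lp_tendsto p f L F" "lp_tendsto p f M F" "F \<noteq> bot"
  shows "L = M"
  using lp_tendsto_coordinate[OF assms(1,2)] lp_tendsto_coordinate[OF assms(1,3)]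
  by (intro ext tendsto_unique[OF assms(4)])

lemma eventually_lp_at_in_lp_space: "\<forall>\<^sub>F u in lp_at p x. u \<in> lp_space p"
  unfolding lp_at_def lp_nhds_def eventually_inf_principal by simp

lemma eventually_lp_at_neq: "\<forall>\<^sub>F u in lp_at p x. u \<noteq> x"
  by (simp add: lp_at_def eventually_inf_principal)

lemma lp_norm_tendsto_lp_at_zero: "((\<lambda>u. lp_norm p u) \<longlongrightarrow> 0) (lp_at p lp_zero)"
proof -
  have "((\<lambda>u. lp_norm p u) \<longlongrightarrow> 0) (lp_nhds p lp_zero)"
    using lp_nhds_limits(1)[of p lp_zero] by (simp add: lp_zero_def)
  then show ?thesis by (rule tendsto_mono[rotated]) (simp add: lp_at_def)
qed

section \<open>Gateaux and Frechet derivatives\<close>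

lemma gateaux_deriv_eqI:
  assumes "0 < q" "has_gateaux_limit q G x v L"
  shows "gateaux_deriv q G x v = L"
  unfolding gateaux_deriv_def
proof (rule the_equality[where P = "\<lambda>L. has_gateaux_limit q G x v L", OF assms(2)])
  fix M assume "has_gateaux_limit q G x v M"
  with assms show "M = L"
    unfolding has_gateaux_limit_def by (intro lp_tendsto_unique[OF assms(1)]) auto
qed

text \<open>Restricting the Frechet limit to the line through \<open>v\<close> gives the quotient in the direction
  \<open>v\<close>, up to the factor \<open>\<bar>t\<bar> * lp_norm p v / t\<close>, which is bounded.\<close>

lemma has_frechet_deriv_imp_gateaux:
  assumes "0 < p" "0 < q" "has_frechet_deriv p q G A x" "v \<in> lp_space p" "v \<noteq> lp_zero"
  shows "has_gateaux_limit q G x v (A v)"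
proof -
  have A: "A v \<in> lp_space q" "\<And>c. A (\<lambda>n. c * v n) = (\<lambda>n. c * A v n)"
    using assms(3,4) by (auto simp: has_frechet_deriv_def lp_continuous_linear_def)
  define R where "R = (\<lambda>u n. (G (\<lambda>k. x k + u k) n - G x n - A u n) / lp_norm p u)"
  define line where "line = (\<lambda>t n. t * v n)"
  have v0: "0 < lp_norm p v" by (rule lp_norm_pos[OF assms(1,4,5)])
  have norm_line: "lp_norm p (line t) = \<bar>t\<bar> * lp_norm p v" for t
    unfolding line_def by (rule lp_norm_scale[OF assms(1,4)])
  have "((\<lambda>t. \<bar>t\<bar> * lp_norm p v) \<longlongrightarrow> 0) (at (0::real))"
    by (auto intro!: tendsto_eq_intros)
  then have "filterlim line (lp_nhds p lp_zero) (at (0::real))"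
    unfolding filterlim_lp_nhds lp_zero_def using norm_line assms(4)
    by (simp add: line_def lp_space_scale)
  moreover have "line t \<noteq> lp_zero" if "t \<noteq> 0" for t
    using norm_line[of t] v0 that lp_norm_lp_zero[of p] by auto
  then have "\<forall>\<^sub>F t in at (0::real). line t \<in> - {lp_zero}"
    by (auto simp: eventually_at_filter)
  ultimately have line: "filterlim line (lp_at p lp_zero) (at (0::real))"
    by (simp add: lp_at_def filterlim_inf filterlim_principal)
  have "filterlim R (lp_nhds q lp_zero) (lp_at p lp_zero)"
    using assms(3) by (simp add: has_frechet_deriv_def lp_tendsto_def R_def)
  then have "filterlim (\<lambda>t. R (line t)) (lp_nhds q lp_zero) (at 0)"
    using line by (rule filterlim_compose)
  then have R: "((\<lambda>t. lp_norm q (R (line t))) \<longlongrightarrow> 0) (at 0)"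
    "\<forall>\<^sub>F t in at 0. R (line t) \<in> lp_space q"
    by (auto simp: filterlim_lp_nhds lp_zero_def)
  define Q where "Q = (\<lambda>t n. (G (\<lambda>k. x k + t * v k) n - G x n) / t)"
  have Q: "Q t n - A v n = (\<bar>t\<bar> * lp_norm p v / t) * R (line t) n" if "t \<noteq> 0" for t n
  proof -
    have "A (line t) n = t * A v n" unfolding line_def A(2) ..
    then show ?thesis
      unfolding R_def norm_line Q_def using that v0 by (simp add: line_def field_simps)
  qed
  have Q_norm: "\<forall>\<^sub>F t in at 0. Q t \<in> lp_space q \<and>
      lp_norm p v * lp_norm q (R (line t)) = lp_norm q (\<lambda>n. Q t n - A v n)"
    using R(2) eventually_neq_at_within[of 0]
  proof eventually_elim
    case (elim t)
    have eq: "(\<lambda>n. Q t n - A v n) = (\<lambda>n. (\<bar>t\<bar> * lp_norm p v / t) * R (line t) n)"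
      using Q[OF elim(2)] by (rule ext)
    have "Q t = (\<lambda>n. (\<bar>t\<bar> * lp_norm p v / t) * R (line t) n + A v n)"
      using Q[OF elim(2)] by (auto simp: fun_eq_iff algebra_simps)
    moreover have "\<dots> \<in> lp_space q"
      by (intro lp_space_add lp_space_scale elim A assms)
    moreover have "\<bar>\<bar>t\<bar> * lp_norm p v / t\<bar> = lp_norm p v"
      using elim(2) v0 by (simp add: abs_mult)
    ultimately show ?case
      unfolding eq lp_norm_scale[OF assms(2) elim(1)] by simp
  qed
  have "((\<lambda>t. lp_norm p v * lp_norm q (R (line t))) \<longlongrightarrow> 0) (at 0)"
    using tendsto_mult_left[OF R(1), of "lp_norm p v"] by simp
  then have "((\<lambda>t. lp_norm q (\<lambda>n. Q t n - A v n)) \<longlongrightarrow> 0) (at 0)"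
    by (rule Lim_transform_eventually) (use Q_norm in \<open>auto elim: eventually_mono\<close>)
  moreover have "\<forall>\<^sub>F t in at 0. Q t \<in> lp_space q"
    using Q_norm by (auto elim: eventually_mono)
  ultimately show ?thesis
    using A(1) by (simp add: has_gateaux_limit_def lp_tendsto_iff Q_def)
qed

text \<open>Two Frechet derivatives agree on nonzero vectors because both are Gateaux derivatives there,
  at the origin by linearity, and outside \<open>l_p\<close> by extensionality.\<close>

lemma frechet_deriv_eqI:
  assumes "0 < p" "0 < q" "has_frechet_deriv p q G A x"
  shows "frechet_deriv p q G x = A"
  unfolding frechet_deriv_def
proof (rule the_equality[where P = "\<lambda>A. has_frechet_deriv p q G A x", OF assms(3)])
  fix B assume B: "has_frechet_deriv p q G B x"
  have linear: "lp_continuous_linear p q A" "lp_continuous_linear p q B"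
    using assms(3) B by (auto simp: has_frechet_deriv_def)
  show "B = A"
  proof
    fix v
    consider "v \<notin> lp_space p" | "v = lp_zero" | "v \<in> lp_space p" "v \<noteq> lp_zero" by blast
    then show "B v = A v"
    proof cases
      case 1
      then show ?thesis
        using linear by (auto simp: lp_continuous_linear_def dest!: PiE_arb)
    next
      case 2
      have "T lp_zero = lp_zero" if "lp_continuous_linear p q T" for T
      proof -
        have "T (\<lambda>n. 0 * lp_zero n) = (\<lambda>n. 0 * T lp_zero n)"
          using that lp_zero_in_lp_space unfolding lp_continuous_linear_def by blast
        then show ?thesis by (simp add: lp_zero_def)
      qed
      then show ?thesis using linear 2 by simp
    next
      case 3
      have "has_gateaux_limit q G x v (A v)" "has_gateaux_limit q G x v (B v)"
        using has_frechet_deriv_imp_gateaux[OF assms(1,2) _ 3] assms(3) B by auto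
      then show ?thesis
        using gateaux_deriv_eqI[OF assms(2)] by metis
    qed
  qed
qed

text \<open>Only increments of the map along \<open>l_p\<close> enter the definition, so an added constant and the
  values outside \<open>l_p\<close> do not affect the derivative.\<close>

lemma has_frechet_deriv_transfer:
  assumes "has_frechet_deriv p q G A x"
    and "\<And>u n. u \<in> lp_space p \<Longrightarrow>
           H (\<lambda>k. x k + u k) n - H x n = G (\<lambda>k. x k + u k) n - G x n"
  shows "has_frechet_deriv p q H A x"
  unfolding has_frechet_deriv_def
proof (intro conjI)
  show "lp_continuous_linear p q A" using assms(1) by (simp add: has_frechet_deriv_def)
  show "lp_tendsto q (\<lambda>u n. (H (\<lambda>k. x k + u k) n - H x n - A u n) / lp_norm p u)
      lp_zero (lp_at p lp_zero)"
  proof (rule lp_tendsto_cong)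
    show "lp_tendsto q (\<lambda>u n. (G (\<lambda>k. x k + u k) n - G x n - A u n) / lp_norm p u)
        lp_zero (lp_at p lp_zero)"
      using assms(1) by (simp add: has_frechet_deriv_def)
    show "\<forall>\<^sub>F u in lp_at p lp_zero. (\<lambda>n. (G (\<lambda>k. x k + u k) n - G x n - A u n) / lp_norm p u) =
        (\<lambda>n. (H (\<lambda>k. x k + u k) n - H x n - A u n) / lp_norm p u)"
      using eventually_lp_at_in_lp_space by (rule eventually_mono) (simp add: assms(2))
  qed
qed

section \<open>Taylor expansion of the scalar duality function\<close>

lemma abs_powr_tendsto_0: "0 < r \<Longrightarrow> ((\<lambda>h. \<bar>h\<bar> powr r) \<longlongrightarrow> 0) (at (0::real))"
  by (rule tendsto_eq_intros | simp)+

text \<open>Away from 0 the functions \<open>\<bar>s\<bar> powr r * sgn s\<close> and \<open>\<bar>s\<bar> powr r\<close> are, up to sign, a power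
  of \<open>s\<close> or \<open>- s\<close>; at 0 their difference quotients have absolute value \<open>\<bar>h\<bar> powr (r - 1)\<close>.\<close>

lemma DERIV_signed_powr:
  fixes s r :: real
  assumes "1 < r"
  shows "((\<lambda>s. \<bar>s\<bar> powr r * sgn s) has_real_derivative r * \<bar>s\<bar> powr (r - 1)) (at s)"
proof -
  consider "0 < s" | "s < 0" | "s = 0" by linarith
  then show ?thesis
  proof cases
    case 1
    have "((\<lambda>s. s powr r) has_real_derivative r * \<bar>s\<bar> powr (r - 1)) (at s)"
      using 1 by (auto intro!: derivative_eq_intros)
    then show ?thesis
      by (rule has_field_derivative_transform_within_open[of _ _ _ "{0<..}"]) (use 1 in auto)
  next
    case 2
    have "((\<lambda>s. - ((- s) powr r)) has_real_derivative r * \<bar>s\<bar> powr (r - 1)) (at s)"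
      using 2 by (auto intro!: derivative_eq_intros)
    then show ?thesis
      by (rule has_field_derivative_transform_within_open[of _ _ _ "{..<0}"]) (use 2 in auto)
  next
    case 3
    have quotient: "\<bar>h\<bar> powr (r - 1) = \<bar>h\<bar> powr r * sgn h / h" if "h \<noteq> 0" for h :: real
      using that by (simp add: powr_diff sgn_if)
    have "((\<lambda>h. \<bar>h\<bar> powr r * sgn h / h) \<longlongrightarrow> 0) (at 0)"
      by (rule Lim_transform_eventually[OF abs_powr_tendsto_0[of "r - 1"]])
        (use assms quotient in \<open>auto simp: eventually_at_filter\<close>)
    then show ?thesis using 3 by (simp add: DERIV_def)
  qed
qed

lemma DERIV_abs_powr:
  fixes s r :: real
  assumes "1 < r"
  shows "((\<lambda>s. \<bar>s\<bar> powr r) has_real_derivative r * \<bar>s\<bar> powr (r - 1) * sgn s) (at s)"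
proof -
  consider "0 < s" | "s < 0" | "s = 0" by linarith
  then show ?thesis
  proof cases
    case 1
    have "((\<lambda>s. s powr r) has_real_derivative r * \<bar>s\<bar> powr (r - 1) * sgn s) (at s)"
      using 1 by (auto intro!: derivative_eq_intros)
    then show ?thesis
      by (rule has_field_derivative_transform_within_open[of _ _ _ "{0<..}"]) (use 1 in auto)
  next
    case 2
    have "((\<lambda>s. (- s) powr r) has_real_derivative r * \<bar>s\<bar> powr (r - 1) * sgn s) (at s)"
      using 2 by (auto intro!: derivative_eq_intros)
    then show ?thesis
      by (rule has_field_derivative_transform_within_open[of _ _ _ "{..<0}"]) (use 2 in auto)
  next
    case 3
    have quotient: "\<bar>h\<bar> powr (r - 1) = \<bar>\<bar>h\<bar> powr r / h\<bar>" if "h \<noteq> 0" for h :: real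
      using that by (simp add: powr_diff)
    have "((\<lambda>h. \<bar>\<bar>h\<bar> powr r / h\<bar>) \<longlongrightarrow> 0) (at 0)"
      by (rule Lim_transform_eventually[OF abs_powr_tendsto_0[of "r - 1"]])
        (use assms quotient in \<open>auto simp: eventually_at_filter\<close>)
    then have "((\<lambda>h. \<bar>h\<bar> powr r / h) \<longlongrightarrow> 0) (at 0)"
      by (rule tendsto_rabs_zero_cancel)
    then show ?thesis using 3 by (simp add: DERIV_def)
  qed
qed

text \<open>The mean value theorem in a form that does not depend on the sign of the increment.\<close>

lemma MVT_increment:
  fixes f f' :: "real \<Rightarrow> real"
  assumes "\<And>z. (f has_real_derivative f' z) (at z)"
  obtains \<xi> where "\<bar>\<xi> - s\<bar> \<le> \<bar>t\<bar>" "f (s + t) - f s = t * f' \<xi>"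
proof -
  consider "0 < t" | "t < 0" | "t = 0" by linarith
  then show thesis
  proof cases
    case 1
    then obtain z where "s < z" "z < s + t" "f (s + t) - f s = (s + t - s) * f' z"
      using MVT2[of s "s + t" f f'] assms by auto
    then show thesis using that[of z] by simp
  next
    case 2
    then obtain z where "s + t < z" "z < s" "f s - f (s + t) = (s - (s + t)) * f' z"
      using MVT2[of "s + t" s f f'] assms by auto
    then show thesis using that[of z] by (simp add: algebra_simps)
  next
    case 3
    then show thesis using that[of s] by simp
  qed
qed

lemma signed_powr_taylor_bound:
  fixes s t p :: real
  assumes "3 < p"
  shows "\<bar>\<bar>s + t\<bar> powr (p - 1) * sgn (s + t) - \<bar>s\<bar> powr (p - 1) * sgn s
            - (p - 1) * \<bar>s\<bar> powr (p - 2) * t\<bar>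
         \<le> (p - 1) * (p - 2) * ((\<bar>s\<bar> + \<bar>t\<bar>) powr (p - 3) * t\<^sup>2)"
proof -
  obtain \<xi> where \<xi>: "\<bar>\<xi> - s\<bar> \<le> \<bar>t\<bar>"
    "\<bar>s + t\<bar> powr (p - 1) * sgn (s + t) - \<bar>s\<bar> powr (p - 1) * sgn s
       = t * ((p - 1) * \<bar>\<xi>\<bar> powr (p - 1 - 1))"
    using MVT_increment[OF DERIV_signed_powr[of "p - 1"], of s t] assms by auto
  obtain \<eta> where \<eta>: "\<bar>\<eta> - s\<bar> \<le> \<bar>\<xi> - s\<bar>"
    "\<bar>s + (\<xi> - s)\<bar> powr (p - 2) - \<bar>s\<bar> powr (p - 2)
       = (\<xi> - s) * ((p - 2) * \<bar>\<eta>\<bar> powr (p - 2 - 1) * sgn \<eta>)"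
    using MVT_increment[OF DERIV_abs_powr[of "p - 2"], of s "\<xi> - s"] assms by auto
  have "\<bar>\<eta>\<bar> powr (p - 3) \<le> (\<bar>s\<bar> + \<bar>t\<bar>) powr (p - 3)"
    using \<xi>(1) \<eta>(1) assms by (intro powr_mono2) auto
  then have \<eta>_bound: "\<bar>\<bar>\<eta>\<bar> powr (p - 3) * sgn \<eta>\<bar> \<le> (\<bar>s\<bar> + \<bar>t\<bar>) powr (p - 3)"
    by (auto simp: abs_mult sgn_if)
  have "\<bar>s + t\<bar> powr (p - 1) * sgn (s + t) - \<bar>s\<bar> powr (p - 1) * sgn s
            - (p - 1) * \<bar>s\<bar> powr (p - 2) * t
      = (p - 1) * t * (\<bar>\<xi>\<bar> powr (p - 2) - \<bar>s\<bar> powr (p - 2))"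
    unfolding \<xi>(2) by (simp add: algebra_simps)
  also have "\<dots> = (p - 1) * (p - 2) * (t * (\<xi> - s) * (\<bar>\<eta>\<bar> powr (p - 3) * sgn \<eta>))"
    using \<eta>(2) by simp
  finally have "\<bar>\<bar>s + t\<bar> powr (p - 1) * sgn (s + t) - \<bar>s\<bar> powr (p - 1) * sgn s
            - (p - 1) * \<bar>s\<bar> powr (p - 2) * t\<bar>
      = (p - 1) * (p - 2) * (\<bar>t\<bar> * \<bar>\<xi> - s\<bar> * \<bar>\<bar>\<eta>\<bar> powr (p - 3) * sgn \<eta>\<bar>)"
    using assms by (simp add: abs_mult)
  also have "\<dots> \<le> (p - 1) * (p - 2) * (\<bar>t\<bar> * \<bar>t\<bar> * (\<bar>s\<bar> + \<bar>t\<bar>) powr (p - 3))"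
    using assms \<xi>(1) \<eta>_bound by (intro mult_left_mono mult_mono) auto
  also have "\<dots> = (p - 1) * (p - 2) * ((\<bar>s\<bar> + \<bar>t\<bar>) powr (p - 3) * t\<^sup>2)"
    by (simp add: power2_eq_square)
  finally show ?thesis .
qed

section \<open>Frechet derivative of the duality mapping\<close>

lemma diagonal_operator_continuous_linear:
  assumes "2 < p" "1 / p + 1 / q = 1" "y \<in> lp_space p"
  shows "lp_continuous_linear p q (diagonal_operator p (\<lambda>n. (p - 1) * \<bar>y n\<bar> powr (p - 2)))"
    (is "lp_continuous_linear p q ?D")
proof -
  have p0: "0 < p" "1 < p" using assms(1) by auto
  define c where "c = (power_sum p y + 1) powr (1 / q)"
  have D: "?D v \<in> lp_space q" "lp_norm q (?D v) \<le> (p - 1) * c * lp_norm p v"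
    if v: "v \<in> lp_space p" for v
  proof -
    have "\<bar>?D v n\<bar> \<le> (p - 1) * (\<bar>y n\<bar> powr (p - 2) * \<bar>v n\<bar> powr 1)" for n
      using v p0 by (simp add: diagonal_operator_def abs_mult)
    note bound = lp_norm_product_bound[OF p0(2) assms(2,3) v _ _ _ _ this]
    show "?D v \<in> lp_space q" by (rule bound(1)) (use assms(1) in auto)
    have "lp_norm q (?D v) \<le> (p - 1) * c * lp_norm p v powr 1"
      unfolding c_def by (rule bound(2)) (use assms(1) in auto)
    then show "lp_norm q (?D v) \<le> (p - 1) * c * lp_norm p v"
      by (simp add: lp_norm_nonneg)
  qed
  have continuous: "lp_tendsto q ?D (?D x) (lp_nhds p x)" if x: "x \<in> lp_space p" for x
  proof -
    note nhds = lp_nhds_limits[of p x]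
    have "\<forall>\<^sub>F u in lp_nhds p x. norm (lp_norm q (\<lambda>n. ?D u n - ?D x n))
        \<le> norm (lp_norm p (\<lambda>n. u n - x n)) * ((p - 1) * c)"
      using nhds(2)
    proof eventually_elim
      case (elim u)
      have ux: "(\<lambda>n. u n - x n) \<in> lp_space p" by (rule lp_space_diff[OF p0(1) elim x])
      have "(\<lambda>n. ?D u n - ?D x n) = ?D (\<lambda>n. u n - x n)"
        using elim x ux by (simp add: diagonal_operator_def algebra_simps)
      then show ?case using D(2)[OF ux] by (simp add: lp_norm_nonneg mult_ac)
    qed
    with nhds(1) have "((\<lambda>u. lp_norm q (\<lambda>n. ?D u n - ?D x n)) \<longlongrightarrow> 0) (lp_nhds p x)"
      by (rule tendsto_0_le)
    moreover have "\<forall>\<^sub>F u in lp_nhds p x. ?D u \<in> lp_space q"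
      using nhds(2) D(1) by (rule eventually_mono)
    ultimately show ?thesis using D(1)[OF x] by (simp add: lp_tendsto_iff)
  qed
  have "?D \<in> lp_space p \<rightarrow>\<^sub>E lp_space q"
    using D(1) by (auto simp: PiE_def extensional_def) (simp add: diagonal_operator_def)
  moreover have "?D (\<lambda>n. u n + v n) = (\<lambda>n. ?D u n + ?D v n)"
    if "u \<in> lp_space p" "v \<in> lp_space p" for u v
    using that lp_space_add[OF p0(1) that] by (simp add: diagonal_operator_def algebra_simps)
  moreover have "?D (\<lambda>n. a * v n) = (\<lambda>n. a * ?D v n)" if "v \<in> lp_space p" for a v
    using that lp_space_scale[OF that] by (simp add: diagonal_operator_def algebra_simps)
  ultimately show ?thesis using continuous by (simp add: lp_continuous_linear_def)
qed

lemma duality_map_has_frechet_deriv: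
  assumes "3 < p" "1 / p + 1 / q = 1" "y \<in> lp_space p"
  shows "has_frechet_deriv p q (duality_map p)
           (diagonal_operator p (\<lambda>n. (p - 1) * \<bar>y n\<bar> powr (p - 2))) y"
    (is "has_frechet_deriv p q _ ?D y")
proof -
  have p0: "0 < p" "1 < p" using assms(1) by auto
  note q0 = conjugate_exponent(1)[OF p0(2) assms(2)]
  define C where "C = (p - 1) * (p - 2)"
  have C: "0 \<le> C" using assms(1) by (simp add: C_def)
  \<comment> \<open>an upper bound for the power sum of \<open>\<bar>y\<bar> + \<bar>u\<bar>\<close> when \<open>lp_norm p u \<le> 1\<close>\<close>
  define M where "M = 2 powr p * (power_sum p y + 1)"
  define r where "r = (\<lambda>u n. duality_map p (\<lambda>k. y k + u k) n - duality_map p y n - ?D u n)"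
  have remainder: "(\<lambda>n. r u n / lp_norm p u) \<in> lp_space q \<and>
      lp_norm q (\<lambda>n. r u n / lp_norm p u) \<le> C * (M + 1) powr (1 / q) * lp_norm p u"
    if u: "u \<in> lp_space p" "u \<noteq> lp_zero" "lp_norm p u \<le> 1" for u
  proof -
    define a where "a = (\<lambda>n. \<bar>y n\<bar> + \<bar>u n\<bar>)"
    have a: "a \<in> lp_space p" "power_sum p a \<le> 2 powr p * (power_sum p y + power_sum p u)"
      using power_sum_add_bound[OF p0(1) assms(3) u(1), of a] by (auto simp: a_def)
    have "power_sum p u \<le> 1"
      using lp_norm_powr[OF p0(1) u(1)] u(3) lp_norm_nonneg[of p u] p0(1)
        powr_le1[of p "lp_norm p u"] by simp
    then have "2 powr p * (power_sum p y + power_sum p u) \<le> M"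
      unfolding M_def by (intro mult_left_mono) auto
    with a(2) have aM: "power_sum p a \<le> M" by linarith
    have "\<bar>r u n\<bar> \<le> C * (\<bar>a n\<bar> powr (p - 3) * \<bar>u n\<bar> powr 2)" for n
      using signed_powr_taylor_bound[OF assms(1), of "y n" "u n"] u(1)
      by (simp add: r_def duality_map_def diagonal_operator_def C_def a_def)
    note bound = lp_norm_product_bound[OF p0(2) assms(2) a(1) u(1) _ _ _ C this]
    have h: "0 < lp_norm p u" by (rule lp_norm_pos[OF p0(1) u(1,2)])
    have r: "r u \<in> lp_space q" by (rule bound(1)) (use assms(1) in auto)
    have "lp_norm q (r u) \<le> C * (power_sum p a + 1) powr (1 / q) * lp_norm p u powr 2"
      by (rule bound(2)) (use assms(1) in auto)
    also have "\<dots> \<le> C * (M + 1) powr (1 / q) * lp_norm p u powr 2"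
      using C aM q0 power_sum_nonneg[OF a(1)]
      by (intro mult_right_mono mult_left_mono powr_mono2) auto
    finally have r_norm: "lp_norm q (r u) \<le> C * (M + 1) powr (1 / q) * (lp_norm p u)\<^sup>2"
      using h by simp
    have quotient: "(\<lambda>n. r u n / lp_norm p u) = (\<lambda>n. (1 / lp_norm p u) * r u n)" by simp
    have "lp_norm q (\<lambda>n. r u n / lp_norm p u) = lp_norm q (r u) / lp_norm p u"
      unfolding quotient lp_norm_scale[OF q0 r] using h by simp
    also have "\<dots> \<le> C * (M + 1) powr (1 / q) * lp_norm p u"
      using r_norm h by (simp add: divide_le_eq power2_eq_square mult.assoc)
    finally show ?thesis
      unfolding quotient using lp_space_scale[OF r] by blast
  qed
  have "\<forall>\<^sub>F u in lp_at p lp_zero. lp_norm p u < 1"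
    by (rule order_tendstoD(2)[OF lp_norm_tendsto_lp_at_zero]) simp
  then have ev: "\<forall>\<^sub>F u in lp_at p lp_zero. (\<lambda>n. r u n / lp_norm p u) \<in> lp_space q \<and>
      norm (lp_norm q (\<lambda>n. r u n / lp_norm p u)) \<le> norm (lp_norm p u) * (C * (M + 1) powr (1 / q))"
    using eventually_lp_at_in_lp_space[of p lp_zero] eventually_lp_at_neq[of lp_zero p]
    by eventually_elim (use remainder in \<open>auto simp: lp_norm_nonneg mult_ac\<close>)
  have "((\<lambda>u. lp_norm q (\<lambda>n. r u n / lp_norm p u)) \<longlongrightarrow> 0) (lp_at p lp_zero)"
    by (rule tendsto_0_le[OF lp_norm_tendsto_lp_at_zero]) (use ev in \<open>auto elim: eventually_mono\<close>)
  moreover have "\<forall>\<^sub>F u in lp_at p lp_zero. (\<lambda>n. r u n / lp_norm p u) \<in> lp_space q"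
    using ev by (auto elim: eventually_mono)
  ultimately have "lp_tendsto q (\<lambda>u n. r u n / lp_norm p u) lp_zero (lp_at p lp_zero)"
    using lp_zero_in_lp_space[of q] by (simp add: lp_tendsto_iff lp_zero_def)
  moreover have "lp_continuous_linear p q ?D"
    by (rule diagonal_operator_continuous_linear) (use assms in auto)
  ultimately show ?thesis by (simp add: has_frechet_deriv_def r_def)
qed

section \<open>The normalized duality mapping at the origin\<close>

lemma normalized_duality_map_scale:
  assumes "0 < p" "v \<in> lp_space p"
  shows "normalized_duality_map p (\<lambda>n. t * v n) = (\<lambda>n. t * normalized_duality_map p v n)"
proof (cases "t = 0 \<or> v = lp_zero")
  case True
  then show ?thesis by (auto simp: normalized_duality_map_def lp_zero_def)
next
  case False
  then have t: "t \<noteq> 0" and v: "v \<noteq> lp_zero" by auto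
  have tv: "(\<lambda>n. t * v n) \<noteq> lp_zero" using t v by (auto simp: lp_zero_def fun_eq_iff)
  have "\<bar>t\<bar> powr (p - 1) = \<bar>t\<bar> * \<bar>t\<bar> powr (p - 2)"
    using powr_add[of "\<bar>t\<bar>" 1 "p - 2"] by simp
  then have "\<bar>t\<bar> powr (p - 1) * sgn t = t * \<bar>t\<bar> powr (p - 2)"
    by (simp add: sgn_if)
  then have ratio: "(\<bar>t\<bar> powr (p - 1) * sgn t) / \<bar>t\<bar> powr (p - 2) = t"
    using t by simp
  have "\<bar>t * v n\<bar> powr (p - 1) * sgn (t * v n) / lp_norm p (\<lambda>n. t * v n) powr (p - 2)
      = (\<bar>t\<bar> powr (p - 1) * sgn t) / \<bar>t\<bar> powr (p - 2)
          * (\<bar>v n\<bar> powr (p - 1) * sgn (v n) / lp_norm p v powr (p - 2))" for n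
    by (simp add: lp_norm_scale[OF assms] abs_mult powr_mult sgn_mult lp_norm_nonneg mult_ac)
  then have "\<bar>t * v n\<bar> powr (p - 1) * sgn (t * v n) / lp_norm p (\<lambda>n. t * v n) powr (p - 2)
      = t * (\<bar>v n\<bar> powr (p - 1) * sgn (v n) / lp_norm p v powr (p - 2))" for n
    unfolding ratio .
  then show ?thesis using v tv by (simp add: normalized_duality_map_def)
qed

lemma normalized_duality_map_gateaux_at_zero:
  assumes "1 < p" "1 / p + 1 / q = 1" "v \<in> lp_space p"
    and H: "\<And>u n. u \<in> lp_space p \<Longrightarrow> H u n = normalized_duality_map p u n + b n"
  shows "has_gateaux_limit q H lp_zero v (normalized_duality_map p v)"
  unfolding has_gateaux_limit_def
proof (rule lp_tendsto_cong[OF lp_tendsto_const])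
  show "normalized_duality_map p v \<in> lp_space q"
    by (rule normalized_duality_map_in_lp_space[OF assms(1,2,3)])
  have "normalized_duality_map p v n = (H (\<lambda>k. lp_zero k + t * v k) n - H lp_zero n) / t"
    if "t \<noteq> 0" for t n
  proof -
    have "(\<lambda>k. lp_zero k + t * v k) = (\<lambda>k. t * v k)" by (simp add: lp_zero_def)
    moreover have "normalized_duality_map p lp_zero n = 0"
      by (simp add: normalized_duality_map_def) (simp add: lp_zero_def)
    moreover have "normalized_duality_map p (\<lambda>k. t * v k) = (\<lambda>k. t * normalized_duality_map p v k)"
      using assms by (intro normalized_duality_map_scale) auto
    ultimately show ?thesis
      using that H[OF lp_space_scale[OF assms(3), of t]] H[OF lp_zero_in_lp_space] by simp
  qed
  then show "\<forall>\<^sub>F t in at 0. normalized_duality_map p v =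
      (\<lambda>n. (H (\<lambda>k. lp_zero k + t * v k) n - H lp_zero n) / t)"
    unfolding eventually_at_filter by (intro always_eventually allI impI ext)
qed

text \<open>With \<open>u\<close> and \<open>v\<close> the first two unit vectors, \<open>J u + J v\<close> has coordinate 1 at index 0,
  while the division by \<open>lp_norm p (u + v) powr (p - 2) = 2 powr ((p - 2) / p)\<close> makes that
  coordinate of \<open>J (u + v)\<close> smaller than 1.\<close>

lemma normalized_duality_map_not_additive:
  assumes "2 < p"
  obtains u v where "u \<in> lp_space p" "v \<in> lp_space p" "u \<noteq> lp_zero" "v \<noteq> lp_zero"
    "(\<lambda>n. u n + v n) \<noteq> lp_zero"
    "normalized_duality_map p (\<lambda>n. u n + v n) \<noteq>
       (\<lambda>n. normalized_duality_map p u n + normalized_duality_map p v n)"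
proof -
  define e :: "nat set \<Rightarrow> nat \<Rightarrow> real" where "e = (\<lambda>A n. if n \<in> A then 1 else 0)"
  have e_powr: "\<bar>e A n\<bar> powr p = e A n" for A n by (simp add: e_def)
  have e_sums: "e A sums card A" if "finite A" for A
    using sums_If_finite_set[OF that, of "\<lambda>_. 1::real"] by (simp add: e_def)
  have e_lp: "e A \<in> lp_space p" if "finite A" for A
    unfolding lp_space_def mem_Collect_eq e_powr using e_sums[OF that] by (rule sums_summable)
  have e_norm: "lp_norm p (e A) = card A powr (1 / p)" if "finite A" for A
    using sums_unique[OF e_sums[OF that]] by (simp add: lp_norm_def e_powr)
  have e_nonzero: "e A \<noteq> lp_zero" if "n \<in> A" for A n
    using that by (auto simp: e_def lp_zero_def fun_eq_iff)
  have J: "normalized_duality_map p (e A) 0 = e A 0 / (card A powr (1 / p)) powr (p - 2)"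
    if "finite A" "n \<in> A" for A n
    using e_nonzero[OF that(2)] e_norm[OF that(1)]
    by (simp add: normalized_duality_map_def) (simp add: e_def)
  have sum: "(\<lambda>n. e {0} n + e {1} n) = e {0, 1}" by (auto simp: e_def)
  have "1 < (2 powr (1 / p)) powr (p - 2)"
    using assms by (simp add: powr_powr)
  then have "normalized_duality_map p (e {0, 1}) 0
      \<noteq> normalized_duality_map p (e {0}) 0 + normalized_duality_map p (e {1}) 0"
    using J[of "{0, 1}" 0] J[of "{0}" 0] J[of "{1}" 1] by (simp add: e_def)
  moreover have "e {0, 1} \<noteq> lp_zero" by (rule e_nonzero[of 0]) simp
  ultimately show thesis
    by (intro that[of "e {0}" "e {1}"])
      (auto simp: sum[simplified] e_lp e_nonzero dest: fun_cong[of _ _ 0])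
qed

section \<open>Partial derivatives of the sum of the two mappings\<close>

theorem theorem2p12:
  fixes p q :: real
    and F :: "(nat \<Rightarrow> real) \<times> (nat \<Rightarrow> real) \<Rightarrow> (nat \<Rightarrow> real)"
    and x y :: "nat \<Rightarrow> real"
  assumes "3 < p" and "1 / p + 1 / q = 1"
    and "\<And>u w. u \<in> lp_space p \<Longrightarrow> w \<in> lp_space p \<Longrightarrow>
           F (u, w) = (\<lambda>n. normalized_duality_map p u n + duality_map p w n)"
    and "x \<in> lp_space p" and "y \<in> lp_space p"
  shows
    "(partial_gateaux_differentiable1 p q F (lp_zero, y) \<and>
      (\<forall>v\<in>lp_space p - {lp_zero}.
         partial_gateaux_deriv1 q F (lp_zero, y) v = normalized_duality_map p v)) \<and>
     \<not> partial_frechet_differentiable1 p q F (lp_zero, y) \<and>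
     (partial_gateaux_differentiable2 p q F (x, y) \<and>
      (\<forall>v\<in>lp_space p - {lp_zero}.
         partial_gateaux_deriv2 q F (x, y) v = partial_frechet_deriv2 p q F (x, y) v \<and>
         partial_frechet_deriv2 p q F (x, y) v = (\<lambda>n. (p - 1) * \<bar>y n\<bar> powr (p - 2) * v n) \<and>
         (\<lambda>n. (p - 1) * \<bar>y n\<bar> powr (p - 2) * v n) \<in> lp_space q)) \<and>
     (partial_frechet_differentiable2 p q F (x, y) \<and>
      frechet_differentiable p q (duality_map p) y \<and>
      partial_frechet_deriv2 p q F (x, y) = frechet_deriv p q (duality_map p) y \<and>
      frechet_deriv p q (duality_map p) y =
        diagonal_operator p (\<lambda>n. (p - 1) * \<bar>y n\<bar> powr (p - 2)))"
proof -
  have p: "0 < p" "1 < p" "2 < p" using assms(1) by auto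
  note q = conjugate_exponent(1)[OF p(2) assms(2)]
  note F = assms(3)
  have gateaux1: "has_gateaux_limit q (\<lambda>u. F (u, y)) lp_zero v (normalized_duality_map p v)"
    if "v \<in> lp_space p" for v
    by (rule normalized_duality_map_gateaux_at_zero[OF p(2) assms(2) that, of _ "duality_map p y"])
      (simp add: F assms(5))
  have 1: "partial_gateaux_differentiable1 p q F (lp_zero, y)"
    unfolding partial_gateaux_differentiable1_def gateaux_differentiable_def
    using gateaux1 by auto
  have 2: "partial_gateaux_deriv1 q F (lp_zero, y) v = normalized_duality_map p v"
    if "v \<in> lp_space p" for v
    using gateaux_deriv_eqI[OF q gateaux1[OF that]] by (simp add: partial_gateaux_deriv1_def)
  have 3: "\<not> partial_frechet_differentiable1 p q F (lp_zero, y)"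
  proof
    assume "partial_frechet_differentiable1 p q F (lp_zero, y)"
    then obtain A where A: "has_frechet_deriv p q (\<lambda>u. F (u, y)) A lp_zero"
      by (auto simp: partial_frechet_differentiable1_def frechet_differentiable_def)
    have AJ: "A v = normalized_duality_map p v" if "v \<in> lp_space p" "v \<noteq> lp_zero" for v
      using gateaux_deriv_eqI[OF q has_frechet_deriv_imp_gateaux[OF p(1) q A that]]
        gateaux_deriv_eqI[OF q gateaux1[OF that(1)]] by simp
    obtain u v where uv: "u \<in> lp_space p" "v \<in> lp_space p" "u \<noteq> lp_zero" "v \<noteq> lp_zero"
      "(\<lambda>n. u n + v n) \<noteq> lp_zero"
      "normalized_duality_map p (\<lambda>n. u n + v n) \<noteq>
         (\<lambda>n. normalized_duality_map p u n + normalized_duality_map p v n)"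
      using normalized_duality_map_not_additive[OF p(3)] .
    have "A (\<lambda>n. u n + v n) = (\<lambda>n. A u n + A v n)"
      using A uv(1,2) by (simp add: has_frechet_deriv_def lp_continuous_linear_def)
    then show False using uv AJ lp_space_add[OF p(1) uv(1,2)] by simp
  qed
  define D where "D = diagonal_operator p (\<lambda>n. (p - 1) * \<bar>y n\<bar> powr (p - 2))"
  have D: "has_frechet_deriv p q (duality_map p) D y"
    unfolding D_def by (rule duality_map_has_frechet_deriv[OF assms(1,2,5)])
  have D_apply: "D v = (\<lambda>n. (p - 1) * \<bar>y n\<bar> powr (p - 2) * v n)" if "v \<in> lp_space p" for v
    using that by (simp add: D_def diagonal_operator_def)
  have D_lq: "D v \<in> lp_space q" if "v \<in> lp_space p" for v
    using D that by (auto simp: has_frechet_deriv_def lp_continuous_linear_def)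
  have FD: "has_frechet_deriv p q (\<lambda>w. F (x, w)) D y"
    by (rule has_frechet_deriv_transfer[OF D])
      (simp add: F assms(4,5) lp_space_add[OF p(1) assms(5)])
  have 4: "partial_frechet_differentiable2 p q F (x, y)" "frechet_differentiable p q (duality_map p) y"
    using D FD by (auto simp: partial_frechet_differentiable2_def frechet_differentiable_def)
  have 5: "partial_frechet_deriv2 p q F (x, y) = D" "frechet_deriv p q (duality_map p) y = D"
    using frechet_deriv_eqI[OF p(1) q] D FD by (auto simp: partial_frechet_deriv2_def)
  have gateaux2: "has_gateaux_limit q (\<lambda>w. F (x, w)) y v (D v)"
    if "v \<in> lp_space p" "v \<noteq> lp_zero" for v
    by (rule has_frechet_deriv_imp_gateaux[OF p(1) q FD that])
  have 6: "partial_gateaux_differentiable2 p q F (x, y)"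
    unfolding partial_gateaux_differentiable2_def gateaux_differentiable_def
    using gateaux2 by auto
  have 7: "partial_gateaux_deriv2 q F (x, y) v = D v" if "v \<in> lp_space p" "v \<noteq> lp_zero" for v
    using gateaux_deriv_eqI[OF q gateaux2[OF that]] by (simp add: partial_gateaux_deriv2_def)
  show ?thesis
  proof (intro conjI ballI)
    fix v assume "v \<in> lp_space p - {lp_zero}"
    then have v: "v \<in> lp_space p" "v \<noteq> lp_zero" by auto
    show "partial_gateaux_deriv1 q F (lp_zero, y) v = normalized_duality_map p v"
      by (rule 2[OF v(1)])
    show "partial_gateaux_deriv2 q F (x, y) v = partial_frechet_deriv2 p q F (x, y) v"
      by (simp add: 5 7[OF v])
    show "partial_frechet_deriv2 p q F (x, y) v = (\<lambda>n. (p - 1) * \<bar>y n\<bar> powr (p - 2) * v n)"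
      by (simp add: 5 D_apply[OF v(1)])
    show "(\<lambda>n. (p - 1) * \<bar>y n\<bar> powr (p - 2) * v n) \<in> lp_space q"
      using D_lq[OF v(1)] by (simp add: D_apply[OF v(1)])
  qed (use 1 3 4 5 6 D_def in auto)
qed

end
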